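(* Let $d$ be a natural number, and let $K$ be a ring of characteristic $2^{d+1}$. Then the map $$\rho^d=\rho^d_K:\mathcal P^{\Phi,d}\to\mathcal M(K):\quad (i,a)\mapsto2^i\,\overline a,\qquad \varnothing_{m,n}\mapsto O_{2^m,2^n}$$ (given on objects by $n\mapsto2^n$) is a faithful involutive tensor category representation. In particular, for each $n\in\mathbb N$ the map $\rho^d$ gives a faithful involutive representation of the monoid $\mathcal P_n^{\Phi,d}$ by $2^n\times2^n$ matrices over $K$.
   Context: **Partition category.** $\mathbb N=\{0,1,2,\ldots\}$, $[n]=\{1,\ldots,n\}$. For $A\subseteq\mathbb N$, $A'$ and $A''$ are disjoint copies of $A$. $\mathcal P_{m,n}$ is the set of all set partitions of $[m]\cup[n]'$; elements of $a$ are called $a$-blocks, and $a$ is identified with any graph whose connected components are its blocks. For $a\in\mathcal P_{m,n}$, $b\in\mathcal P_{n,t}$, the product graph $\Pi(a,b)$ has vertex set $[m]\cup[n]''\cup[t]'$ and edges those of $a$ (lower vertices $x'$ renamed $x''$) and of $b$ (upper vertices $x$ renamed $x''$). $ab\in\mathcal P_{m,t}$ is the partition in which $x,y\in[m]\cup[t]'$ are in the same block iff they are in the same component of $\Pi(a,b)$. $\Phi(a,b)$ is the number of connected components of $\Pi(a,b)$ contained in $[n]''$. Identities are $\iota_n=\{\{i,i'\}:i\in[n]\}$; the involution $a\mapsto a^*$ swaps $i\leftrightarrow i'$; for $a\in\mathcal P_{m,n}$, $b\in\mathcal P_{s,t}$, $a\oplus b\in\mathcal P_{m+s,n+t}$ has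 as blocks all $a$-blocks and $(X+m)\cup(Y+n)'$ for each $b$-block $X\cup Y'$. **$d$-twisted partition category.** $\mathcal P^{\Phi,d}$ has object set $\mathbb N$ and hom-sets $\mathcal P^{\Phi,d}_{m,n}=(\{0,1,\ldots,d\}\times\mathcal P_{m,n})\cup\{\varnothing_{m,n}\}$. For $a\in\mathcal P_{m,n}$, $b\in\mathcal P_{n,t}$: $(i,a)(j,b)=(i+j+\Phi(a,b),ab)$ if $i+j+\Phi(a,b)\le d$, and $=\varnothing_{m,t}$ otherwise. For $a\in\mathcal P_{m,n}$, $b\in\mathcal P_{s,t}$: $(i,a)\oplus(j,b)=(i+j,a\oplus b)$ if $i+j\le d$, and $=\varnothing_{m+s,n+t}$ otherwise. Any composite or tensor sum involving a zero morphism $\varnothing$ is the zero morphism of the appropriate hom-set. Identities are $(0,\iota_n)$. The involution is $(i,a)^*=(i,a^* )$, $\varnothing_{m,n}^*=\varnothing_{n,m}$. $\mathcal P_n^{\Phi,d}=\mathcal P_{n,n}^{\Phi,d}$. **Matrices.** Rings are unital; characteristic $c$ means $c$ is the least positive integer with $1+\cdots+1$ ($c$ terms) equal to $0$; a natural number $k$ is identified with $1+\cdots+1$ ($k$ terms) in $K$. $\mathcal M(K)$ has object set $\mathbb N$, hom-sets $\mathcal M_{m,n}(K)$ of $m\times n$ matrices over $K$, composition matrix multiplication, involution transpose, tensor operation the Kronecker product $\otimes$ (objects multiply). $O_{k,l}$ is the $k\times l$ zero matrix. Matrices in $\mathcal M_{2^m,2^n}(K)$ are regarded as having rows/columns indexed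 by subsets of $[m]$, $[n]$; under this indexing the Kronecker product is $(A\otimes B)_{X\cup(U+m),\,Y\cup(V+n)}=A_{X,Y}B_{U,V}$ for $X\subseteq[m]$, $U\subseteq[s]$, $Y\subseteq[n]$, $V\subseteq[t]$ (for instance, using the bijections $X\mapsto1+\sum_{x\in X}2^{n-x}$ from subsets of $[n]$ to $[2^n]$ this is the usual Kronecker product). For $a\in\mathcal P_{m,n}$, $\overline a\in\mathcal M_{2^m,2^n}(K)$ is defined by $\overline a_{X,Y}=1$ if $X\cup Y'$ is a (possibly empty) union of $a$-blocks, and $0$ otherwise. **Representations.** A category representation is a functor; it is faithful if injective on objects and on morphisms, involutive if it preserves the involutions, and a tensor representation if it preserves the tensor operations. *)

theory Defs
  imports "Jordan_Normal_Form.Matrix" "HOL-Library.Disjoint_Sets"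
begin

section \<open>Partitions\<close>

text \<open>
  The three disjoint copies of the natural numbers: \<open>Upper x\<close> is the plain vertex \<open>x\<close>,
  \<open>Lower x\<close> is the primed vertex, and \<open>Middle x\<close> is the double-primed vertex (used in
  product graphs only).
\<close>

datatype vertex = Upper nat | Lower nat | Middle nat

definition vertices :: "nat \<Rightarrow> nat \<Rightarrow> vertex set" where
  "vertices m n = Upper ` {1..m} \<union> Lower ` {1..n}"

text \<open>
  A partition records its type \<open>(m, n)\<close>. This is redundant for genuine partitions (the blocks
  determine \<open>m\<close> and \<open>n\<close>), but makes domain and codomain directly available.
\<close>

datatype diagram = Diagram (upper: nat) (lower: nat) (blocks: "vertex set set")

definition partitions :: "nat \<Rightarrow> nat \<Rightarrow> diagram set" where
  "partitions m n = {Diagram m n B | B. partition_on (vertices m n) B}"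

fun lower_to_middle :: "vertex \<Rightarrow> vertex" where
  "lower_to_middle (Lower x) = Middle x"
| "lower_to_middle v = v"

fun upper_to_middle :: "vertex \<Rightarrow> vertex" where
  "upper_to_middle (Upper x) = Middle x"
| "upper_to_middle v = v"

definition product_vertices :: "diagram \<Rightarrow> diagram \<Rightarrow> vertex set" where
  "product_vertices a b =
     Upper ` {1..upper a} \<union> Middle ` {1..lower a} \<union> Lower ` {1..lower b}"

text \<open>
  Among the graphs whose connected components are the blocks of a partition, we use the one in
  which any two vertices of the same block are adjacent.
\<close>

definition product_edges :: "diagram \<Rightarrow> diagram \<Rightarrow> (vertex \<times> vertex) set" where
  "product_edges a b =
     (\<Union>A \<in> blocks a. (lower_to_middle ` A) \<times> (lower_to_middle ` A)) \<union>
     (\<Union>B \<in> blocks b. (upper_to_middle ` B) \<times> (upper_to_middle ` B))"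

text \<open>
  The classes into which the set \<open>W\<close> is divided by connectedness in the graph with (symmetric)
  edge relation \<open>E\<close>. If \<open>W\<close> is the full vertex set, these are the connected components.
\<close>

definition connected_classes :: "vertex set \<Rightarrow> (vertex \<times> vertex) set \<Rightarrow> vertex set set" where
  "connected_classes W E = W // (E\<^sup>* \<inter> W \<times> W)"

definition diagram_product :: "diagram \<Rightarrow> diagram \<Rightarrow> diagram" where
  "diagram_product a b =
     Diagram (upper a) (lower b)
       (connected_classes (vertices (upper a) (lower b)) (product_edges a b))"

definition floating :: "diagram \<Rightarrow> diagram \<Rightarrow> nat" where
  "floating a b =
     card {C \<in> connected_classes (product_vertices a b) (product_edges a b).
             C \<subseteq> Middle ` {1..lower a}}"

definition diagram_id :: "nat \<Rightarrow> diagram" where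
  "diagram_id n = Diagram n n {{Upper i, Lower i} | i. i \<in> {1..n}}"

fun swap_vertex :: "vertex \<Rightarrow> vertex" where
  "swap_vertex (Upper x) = Lower x"
| "swap_vertex (Lower x) = Upper x"
| "swap_vertex (Middle x) = Middle x"

definition diagram_star :: "diagram \<Rightarrow> diagram" where
  "diagram_star a = Diagram (lower a) (upper a) ((`) swap_vertex ` blocks a)"

fun shift_vertex :: "nat \<Rightarrow> nat \<Rightarrow> vertex \<Rightarrow> vertex" where
  "shift_vertex m n (Upper x) = Upper (x + m)"
| "shift_vertex m n (Lower x) = Lower (x + n)"
| "shift_vertex m n (Middle x) = Middle x"

definition diagram_sum :: "diagram \<Rightarrow> diagram \<Rightarrow> diagram" where
  "diagram_sum a b =
     Diagram (upper a + upper b) (lower a + lower b)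
       (blocks a \<union> (`) (shift_vertex (upper a) (lower a)) ` blocks b)"


section \<open>Categories with an involution and a tensor operation\<close>

text \<open>
  Composition is written from left to right: \<open>comp C f g\<close> is the composite of
  \<open>f : x \<rightarrow> y\<close> and \<open>g : y \<rightarrow> z\<close>.
\<close>

record ('o, 'm) cat_ops =
  objs :: "'o set"
  mors :: "'m set"
  src :: "'m \<Rightarrow> 'o"
  tgt :: "'m \<Rightarrow> 'o"
  comp :: "'m \<Rightarrow> 'm \<Rightarrow> 'm"
  ident :: "'o \<Rightarrow> 'm"
  star :: "'m \<Rightarrow> 'm"
  tensor_obj :: "'o \<Rightarrow> 'o \<Rightarrow> 'o"
  tensor_mor :: "'m \<Rightarrow> 'm \<Rightarrow> 'm"

definition homset :: "('o, 'm) cat_ops \<Rightarrow> 'o \<Rightarrow> 'o \<Rightarrow> 'm set" where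
  "homset C x y = {f \<in> mors C. src C f = x \<and> tgt C f = y}"

text \<open>
  The involution and the tensor operation are only required to be well typed: for matrices over a
  noncommutative ring, transposition does not reverse products, and the Kronecker product does not
  satisfy the interchange law.
\<close>

locale category_with_ops =
  fixes C :: "('o, 'm) cat_ops"
  assumes src_obj: "f \<in> mors C \<Longrightarrow> src C f \<in> objs C"
    and tgt_obj: "f \<in> mors C \<Longrightarrow> tgt C f \<in> objs C"
    and ident_hom: "x \<in> objs C \<Longrightarrow> ident C x \<in> homset C x x"
    and comp_hom: "f \<in> homset C x y \<Longrightarrow> g \<in> homset C y z \<Longrightarrow> comp C f g \<in> homset C x z"
    and ident_left: "f \<in> homset C x y \<Longrightarrow> comp C (ident C x) f = f"
    and ident_right: "f \<in> homset C x y \<Longrightarrow> comp C f (ident C y) = f"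
    and comp_assoc: "f \<in> homset C w x \<Longrightarrow> g \<in> homset C x y \<Longrightarrow> h \<in> homset C y z \<Longrightarrow>
          comp C (comp C f g) h = comp C f (comp C g h)"
    and star_hom: "f \<in> homset C x y \<Longrightarrow> star C f \<in> homset C y x"
    and tensor_obj_closed: "x \<in> objs C \<Longrightarrow> y \<in> objs C \<Longrightarrow> tensor_obj C x y \<in> objs C"
    and tensor_hom: "f \<in> homset C x y \<Longrightarrow> g \<in> homset C u v \<Longrightarrow>
          tensor_mor C f g \<in> homset C (tensor_obj C x u) (tensor_obj C y v)"

locale category_rep =
  source: category_with_ops S + target: category_with_ops T
  for S :: "('o, 'm) cat_ops" and T :: "('p, 'n) cat_ops" +
  fixes F_obj :: "'o \<Rightarrow> 'p" and F_mor :: "'m \<Rightarrow> 'n"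
  assumes map_obj: "x \<in> objs S \<Longrightarrow> F_obj x \<in> objs T"
    and map_hom: "f \<in> homset S x y \<Longrightarrow> F_mor f \<in> homset T (F_obj x) (F_obj y)"
    and map_comp: "f \<in> homset S x y \<Longrightarrow> g \<in> homset S y z \<Longrightarrow>
          F_mor (comp S f g) = comp T (F_mor f) (F_mor g)"
    and map_ident: "x \<in> objs S \<Longrightarrow> F_mor (ident S x) = ident T (F_obj x)"

locale faithful_rep = category_rep +
  assumes inj_objs: "inj_on F_obj (objs S)"
    and inj_mors: "inj_on F_mor (mors S)"

locale involutive_rep = category_rep +
  assumes map_star: "f \<in> mors S \<Longrightarrow> F_mor (star S f) = star T (F_mor f)"

locale tensor_rep = category_rep +
  assumes map_tensor_obj: "x \<in> objs S \<Longrightarrow> y \<in> objs S \<Longrightarrow>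
        F_obj (tensor_obj S x y) = tensor_obj T (F_obj x) (F_obj y)"
    and map_tensor_mor: "f \<in> mors S \<Longrightarrow> g \<in> mors S \<Longrightarrow>
        F_mor (tensor_mor S f g) = tensor_mor T (F_mor f) (F_mor g)"

definition endo_monoid :: "('o, 'm) cat_ops \<Rightarrow> 'o \<Rightarrow> 'm monoid" where
  "endo_monoid C x = \<lparr>carrier = homset C x x, monoid.mult = comp C, one = ident C x\<rparr>"

definition monoid_rep :: "'m monoid \<Rightarrow> 'n monoid \<Rightarrow> ('m \<Rightarrow> 'n) \<Rightarrow> bool" where
  "monoid_rep M N h \<longleftrightarrow>
     Group.monoid M \<and> Group.monoid N \<and> h \<in> Group.hom M N \<and> h \<one>\<^bsub>M\<^esub> = \<one>\<^bsub>N\<^esub>"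


section \<open>The twisted partition category\<close>

datatype twisted = Tw nat diagram | TwZero nat nat

fun tw_src :: "twisted \<Rightarrow> nat" where
  "tw_src (Tw i a) = upper a"
| "tw_src (TwZero m n) = m"

fun tw_tgt :: "twisted \<Rightarrow> nat" where
  "tw_tgt (Tw i a) = lower a"
| "tw_tgt (TwZero m n) = n"

definition tw_mors :: "nat \<Rightarrow> twisted set" where
  "tw_mors d = {Tw i a | i a. i \<le> d \<and> (\<exists>m n. a \<in> partitions m n)} \<union> {TwZero m n | m n. True}"

fun tw_comp :: "nat \<Rightarrow> twisted \<Rightarrow> twisted \<Rightarrow> twisted" where
  "tw_comp d (Tw i a) (Tw j b) =
     (if i + j + floating a b \<le> d
      then Tw (i + j + floating a b) (diagram_product a b)
      else TwZero (upper a) (lower b))"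
| "tw_comp d f g = TwZero (tw_src f) (tw_tgt g)"

fun tw_sum :: "nat \<Rightarrow> twisted \<Rightarrow> twisted \<Rightarrow> twisted" where
  "tw_sum d (Tw i a) (Tw j b) =
     (if i + j \<le> d
      then Tw (i + j) (diagram_sum a b)
      else TwZero (upper a + upper b) (lower a + lower b))"
| "tw_sum d f g = TwZero (tw_src f + tw_src g) (tw_tgt f + tw_tgt g)"

fun tw_star :: "twisted \<Rightarrow> twisted" where
  "tw_star (Tw i a) = Tw i (diagram_star a)"
| "tw_star (TwZero m n) = TwZero n m"

definition twisted_category :: "nat \<Rightarrow> (nat, twisted) cat_ops" where
  "twisted_category d =
     \<lparr>objs = UNIV, mors = tw_mors d, src = tw_src, tgt = tw_tgt,
      comp = tw_comp d, ident = (\<lambda>n. Tw 0 (diagram_id n)), star = tw_star,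
      tensor_obj = (+), tensor_mor = tw_sum d\<rparr>"

lemma homset_twisted_category:
  "homset (twisted_category d) m n = {Tw i a | i a. i \<le> d \<and> a \<in> partitions m n} \<union> {TwZero m n}"
  by (auto simp: homset_def twisted_category_def tw_mors_def partitions_def)


section \<open>The matrix category\<close>

definition kronecker :: "'k::times mat \<Rightarrow> 'k mat \<Rightarrow> 'k mat" where
  "kronecker A B =
     mat (dim_row A * dim_row B) (dim_col A * dim_col B)
       (\<lambda>(i, j). A $$ (i div dim_row B, j div dim_col B) * B $$ (i mod dim_row B, j mod dim_col B))"

definition matrix_category :: "(nat, 'k::ring_1 mat) cat_ops" where
  "matrix_category =
     \<lparr>objs = UNIV, mors = UNIV, src = dim_row, tgt = dim_col,
      comp = (*), ident = 1\<^sub>m, star = transpose_mat,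
      tensor_obj = (*), tensor_mor = kronecker\<rparr>"

lemma homset_matrix_category:
  "homset (matrix_category :: (nat, 'k::ring_1 mat) cat_ops) m n = carrier_mat m n"
  unfolding homset_def matrix_category_def carrier_mat_def by simp


section \<open>The representation\<close>

text \<open>
  Rows and columns are numbered from \<open>0\<close>; the subset \<open>X\<close> of \<open>{1..n}\<close> has number
  \<open>\<Sum>x\<in>X. 2 ^ (n - x)\<close>, and \<open>subset_at n r\<close> is the subset with number \<open>r < 2 ^ n\<close>.
\<close>

definition subset_index :: "nat \<Rightarrow> nat set \<Rightarrow> nat" where
  "subset_index n X = (\<Sum>x\<in>X. 2 ^ (n - x))"

definition subset_at :: "nat \<Rightarrow> nat \<Rightarrow> nat set" where
  "subset_at n r = {x \<in> {1..n}. odd (r div 2 ^ (n - x))}"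

definition block_matrix :: "diagram \<Rightarrow> 'k::ring_1 mat" where
  "block_matrix a =
     mat (2 ^ upper a) (2 ^ lower a)
       (\<lambda>(r, c). if \<exists>S \<subseteq> blocks a. Upper ` subset_at (upper a) r \<union> Lower ` subset_at (lower a) c = \<Union>S
                 then 1 else 0)"

fun rho :: "twisted \<Rightarrow> 'k::ring_1 mat" where
  "rho (Tw i a) = 2 ^ i \<cdot>\<^sub>m block_matrix a"
| "rho (TwZero m n) = 0\<^sub>m (2 ^ m) (2 ^ n)"

lemma subset_index_Suc:
  assumes "X \<subseteq> {1..Suc n}"
  shows "subset_index (Suc n) X = 2 * subset_index n (X - {Suc n}) + of_bool (Suc n \<in> X)"
proof -
  have fin: "finite X" using assms finite_subset by blast
  have "(\<Sum>x\<in>X - {Suc n}. 2 ^ (Suc n - x)) = (\<Sum>x\<in>X - {Suc n}. 2 * 2 ^ (n - x) :: nat)"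
  proof (rule sum.cong)
    fix x assume "x \<in> X - {Suc n}"
    then have "x \<le> n" using assms by force
    then show "2 ^ (Suc n - x) = 2 * (2 ^ (n - x) :: nat)" by (simp add: Suc_diff_le)
  qed simp
  then have eq: "(\<Sum>x\<in>X - {Suc n}. 2 ^ (Suc n - x)) = 2 * subset_index n (X - {Suc n})"
    by (simp only: subset_index_def sum_distrib_left)
  show ?thesis
  proof (cases "Suc n \<in> X")
    case True
    then show ?thesis
      using sum.remove[OF fin True, of "\<lambda>x. 2 ^ (Suc n - x) :: nat"] eq
      by (simp add: subset_index_def)
  next
    case False
    then show ?thesis using eq by (simp add: subset_index_def)
  qed
qed

lemma subset_index_less: "X \<subseteq> {1..n} \<Longrightarrow> subset_index n X < 2 ^ n"
proof (induction n arbitrary: X)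
  case 0
  then show ?case by (simp add: subset_index_def)
next
  case (Suc n)
  have "X - {Suc n} \<subseteq> {1..n}" using Suc.prems by force
  from Suc.IH[OF this] have "2 * subset_index n (X - {Suc n}) + of_bool (Suc n \<in> X) < 2 * 2 ^ n"
    by (cases "Suc n \<in> X") simp_all
  then show ?case
    by (simp only: subset_index_Suc[OF Suc.prems] power_Suc)
qed

lemma subset_at_Suc:
  "subset_at (Suc n) r = subset_at n (r div 2) \<union> (if odd r then {Suc n} else {})"
proof -
  have "x \<in> subset_at (Suc n) r \<longleftrightarrow> x \<in> subset_at n (r div 2) \<union> (if odd r then {Suc n} else {})" for x
  proof (cases "x \<le> n")
    case True
    then show ?thesis by (simp add: subset_at_def Suc_diff_le div_mult2_eq)
  next
    case False
    then show ?thesis by (cases "x = Suc n") (auto simp: subset_at_def)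
  qed
  then show ?thesis by blast
qed

lemma subset_at_subset: "subset_at n r \<subseteq> {1..n}"
  by (auto simp: subset_at_def)

lemma subset_at_index: "X \<subseteq> {1..n} \<Longrightarrow> subset_at n (subset_index n X) = X"
proof (induction n arbitrary: X)
  case 0
  then show ?case by (simp add: subset_at_def)
next
  case (Suc n)
  have sub: "X - {Suc n} \<subseteq> {1..n}" using Suc.prems by force
  have "subset_index (Suc n) X div 2 = subset_index n (X - {Suc n})"
    and "odd (subset_index (Suc n) X) \<longleftrightarrow> Suc n \<in> X"
    unfolding subset_index_Suc[OF Suc.prems] by (cases "Suc n \<in> X"; simp)+
  then have "subset_at (Suc n) (subset_index (Suc n) X) =
      (X - {Suc n}) \<union> (if Suc n \<in> X then {Suc n} else {})"
    by (simp only: subset_at_Suc Suc.IH[OF sub])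
  then show ?case by (cases "Suc n \<in> X") auto
qed

lemma subset_index_at: "r < 2 ^ n \<Longrightarrow> subset_index n (subset_at n r) = r"
proof (induction n arbitrary: r)
  case 0
  then show ?case by (simp add: subset_at_def subset_index_def)
next
  case (Suc n)
  have notin: "Suc n \<notin> subset_at n (r div 2)" by (simp add: subset_at_def)
  have diff: "subset_at (Suc n) r - {Suc n} = subset_at n (r div 2)"
    and mem: "Suc n \<in> subset_at (Suc n) r \<longleftrightarrow> odd r"
    using notin by (auto simp: subset_at_Suc)
  have "r div 2 < 2 ^ n" using Suc.prems by auto
  from Suc.IH[OF this] have "subset_index (Suc n) (subset_at (Suc n) r) = 2 * (r div 2) + of_bool (odd r)"
    by (simp only: subset_index_Suc[OF subset_at_subset] diff mem)
  then show ?case by (cases "odd r") simp_all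
qed

text \<open>The usual Kronecker product, rewritten in terms of subset indices.\<close>

lemma subset_index_union:
  assumes X: "X \<subseteq> {1..m}" and U: "U \<subseteq> {1..s}"
  shows "subset_index (m + s) (X \<union> (\<lambda>u. u + m) ` U) = 2 ^ s * subset_index m X + subset_index s U"
proof -
  have fin: "finite X" "finite U" using X U finite_subset by blast+
  have "(\<Sum>x\<in>X. 2 ^ (m + s - x)) = (\<Sum>x\<in>X. 2 ^ s * 2 ^ (m - x) :: nat)"
  proof (rule sum.cong)
    fix x assume "x \<in> X"
    then have "m + s - x = s + (m - x)" using X by force
    then show "2 ^ (m + s - x) = 2 ^ s * (2 ^ (m - x) :: nat)" by (simp add: power_add)
  qed simp
  moreover have "(\<Sum>x\<in>(\<lambda>u. u + m) ` U. 2 ^ (m + s - x)) = (\<Sum>u\<in>U. 2 ^ (s - u) :: nat)"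
    by (subst sum.reindex) (auto simp: inj_on_def)
  moreover have "X \<inter> (\<lambda>u. u + m) ` U = {}" using X U by force
  ultimately show ?thesis
    using fin by (simp add: subset_index_def sum.union_disjoint sum_distrib_left)
qed

lemma kronecker_subset_entry:
  assumes "A \<in> carrier_mat (2 ^ m) (2 ^ n)" "B \<in> carrier_mat (2 ^ s) (2 ^ t)"
    and X: "X \<subseteq> {1..m}" and U: "U \<subseteq> {1..s}" and Y: "Y \<subseteq> {1..n}" and V: "V \<subseteq> {1..t}"
  shows "kronecker A B $$ (subset_index (m + s) (X \<union> (\<lambda>u. u + m) ` U),
                          subset_index (n + t) (Y \<union> (\<lambda>v. v + n) ` V)) =
         A $$ (subset_index m X, subset_index n Y) * B $$ (subset_index s U, subset_index t V)"
proof -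
  have sub: "X \<union> (\<lambda>u. u + m) ` U \<subseteq> {1..m + s}" "Y \<union> (\<lambda>v. v + n) ` V \<subseteq> {1..n + t}"
    using X U Y V by force+
  have lt: "2 ^ s * subset_index m X + subset_index s U < 2 ^ m * 2 ^ s"
    "2 ^ t * subset_index n Y + subset_index t V < 2 ^ n * 2 ^ t"
    using sub[THEN subset_index_less]
    by (simp_all only: subset_index_union[OF X U] subset_index_union[OF Y V] power_add)
  have dims: "dim_row A = 2 ^ m" "dim_col A = 2 ^ n" "dim_row B = 2 ^ s" "dim_col B = 2 ^ t"
    using assms(1,2) by auto
  show ?thesis
    using lt subset_index_less[OF U] subset_index_less[OF V]
    by (simp add: kronecker_def dims subset_index_union[OF X U] subset_index_union[OF Y V])
qed

end

theory Submission
  imports Defs "HOL-Number_Theory.Cong"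
begin

text \<open>
  The representation works because an entry of a product of block matrices counts something. Fix
  subsets \<open>X\<close> and \<open>Y\<close> of the outer rows of a product graph. The corresponding entry of the product
  for \<open>a\<close> and \<open>b\<close> is the number of subsets \<open>Z\<close> of the middle row such that \<open>X \<union> Z'\<close> is a union of
  blocks of \<open>a\<close> and \<open>Z \<union> Y'\<close> is a union of blocks of \<open>b\<close>; equivalently, \<open>X \<union> Z'' \<union> Y'\<close> is closed
  under adjacency in the product graph, that is, a union of its components. A component that meets
  the outer rows is forced in or out by \<open>X\<close> and \<open>Y\<close>, and this is consistent precisely when
  \<open>X \<union> Y'\<close> is a union of blocks of the product diagram. A component inside the middle row may be
  chosen freely. Hence the entry is \<open>2 ^ floating a b\<close> times the entry of the block matrix of the
  product diagram (\<open>card_closed_sets_with_trace\<close>, \<open>rho_mult\<close>). So a twist by \<open>i\<close> becomes the scalar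
  \<open>2 ^ i\<close>, and composites that overflow the bound \<open>d\<close> go to zero because \<open>2 ^ (d + 1)\<close> vanishes in
  the ring (\<open>rho_comp\<close>).

  Faithfulness: the entry at the pair of empty sets is \<open>2 ^ i\<close>, and \<open>2 ^ 0, \<dots>, 2 ^ d\<close> are distinct
  and nonzero in characteristic \<open>2 ^ (d + 1)\<close>, so the matrix determines \<open>i\<close>. The nonzero
  entries then tell which vertex sets are unions of blocks, and these sets determine the partition
  (\<open>rho_Tw_inj\<close>).

  Injectivity also yields that the twisted partition category is a category at all: its
  identity and associativity laws hold because their images under \<open>rho\<close> are laws of matrix
  multiplication (\<open>category_twisted\<close>). This replaces a direct count of floating components in
  threefold products.

  The ring may be noncommutative. This causes no difficulty because every entry is the image of a
  natural number, so the calculations are carried out in \<open>nat\<close> and mapped into the ring by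
  \<open>of_nat\<close>.
\<close>

section \<open>Unions of blocks\<close>

text \<open>
  For a partition \<open>B\<close> of a superset of \<open>Q\<close>, this says that \<open>Q\<close> is a union of blocks. Unlike the
  existence of such a union, this form is local to each block, so it behaves well under unions of
  families, images, and changes of \<open>Q\<close> off the vertices concerned.
\<close>

definition saturated :: "'a set set \<Rightarrow> 'a set \<Rightarrow> bool" where
  "saturated B Q \<longleftrightarrow> (\<forall>A\<in>B. \<forall>x\<in>A. \<forall>y\<in>A. x \<in> Q \<longrightarrow> y \<in> Q)"

lemma saturated_iff_union_of_blocks:
  assumes "partition_on V B" "Q \<subseteq> V"
  shows "(\<exists>S\<subseteq>B. Q = \<Union>S) \<longleftrightarrow> saturated B Q"
proof
  assume "\<exists>S\<subseteq>B. Q = \<Union>S"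
  then obtain S where S: "S \<subseteq> B" "Q = \<Union>S" by blast
  show "saturated B Q"
    unfolding saturated_def
  proof (intro ballI impI)
    fix A x y assume "A \<in> B" "x \<in> A" "y \<in> A" "x \<in> Q"
    then obtain C where "C \<in> S" "x \<in> C" using S by blast
    then have "C = A"
      using partition_onD2[OF assms(1)] S(1) \<open>A \<in> B\<close> \<open>x \<in> A\<close>
      by (auto simp: disjoint_def)
    then show "y \<in> Q" using \<open>C \<in> S\<close> \<open>y \<in> A\<close> S(2) by blast
  qed
next
  assume sat: "saturated B Q"
  have "Q = \<Union>{A\<in>B. A \<subseteq> Q}"
    using sat assms(2) partition_onD1[OF assms(1)] unfolding saturated_def by blast
  then show "\<exists>S\<subseteq>B. Q = \<Union>S" by (intro exI[of _ "{A\<in>B. A \<subseteq> Q}"]) blast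
qed

lemma saturated_Un: "saturated (A \<union> B) Q \<longleftrightarrow> saturated A Q \<and> saturated B Q"
  by (auto simp: saturated_def)

lemma saturated_image: "saturated ((`) f ` B) Q \<longleftrightarrow> saturated B (f -` Q)"
  by (auto simp: saturated_def)

lemma saturated_cong:
  assumes "\<And>x. x \<in> \<Union>B \<Longrightarrow> x \<in> Q \<longleftrightarrow> x \<in> R"
  shows "saturated B Q \<longleftrightarrow> saturated B R"
  using assms unfolding saturated_def by (metis UnionI)

text \<open>
  In a graph made of one clique per set of a family, being closed under adjacency is the same as
  being saturated. This turns conditions on two diagrams into one condition on their product graph.
\<close>

lemma Image_cliques_subset_iff: "(\<Union>A\<in>B. A \<times> A) `` Q \<subseteq> Q \<longleftrightarrow> saturated B Q"
  unfolding saturated_def by blast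

text \<open>
  A block \<open>A\<close> of the first partition and the block \<open>D\<close> of the second that meets it at a point \<open>x\<close>
  are each saturated for both partitions. Saturation of \<open>A\<close> for the second gives \<open>D \<subseteq> A\<close>, and
  symmetrically \<open>A \<subseteq> D\<close>.
\<close>

lemma partition_subset_of_same_saturated:
  assumes B: "partition_on V B" and C: "partition_on V C"
    and same: "\<And>Q. Q \<subseteq> V \<Longrightarrow> saturated B Q \<longleftrightarrow> saturated C Q"
  shows "B \<subseteq> C"
proof
  fix A assume A: "A \<in> B"
  have "A \<noteq> {}" "A \<subseteq> V" using A partition_onD3[OF B] partition_onD1[OF B] by auto
  then obtain x where x: "x \<in> A" "x \<in> V" by blast
  then obtain D where D: "D \<in> C" "x \<in> D" using partition_onD1[OF C] by blast
  have "D \<subseteq> V" using D partition_onD1[OF C] by blast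
  have "saturated B A" "saturated C D"
    using A D partition_onD2[OF B] partition_onD2[OF C]
    unfolding saturated_def disjoint_def by blast+
  then have "saturated C A" "saturated B D"
    using same \<open>A \<subseteq> V\<close> \<open>D \<subseteq> V\<close> by blast+
  then have "A = D" using x A D unfolding saturated_def by blast
  then show "A \<in> C" using D by simp
qed

lemma partition_eqI_saturated:
  assumes "partition_on V B" "partition_on V C"
    and "\<And>Q. Q \<subseteq> V \<Longrightarrow> saturated B Q \<longleftrightarrow> saturated C Q"
  shows "B = C"
  using partition_subset_of_same_saturated assms by (metis subset_antisym)

section \<open>Closed vertex sets of a graph\<close>

lemma equiv_connected:
  assumes "sym E"
  shows "equiv U (E\<^sup>* \<inter> U \<times> U)"
proof (rule equivI)
  show "sym (E\<^sup>* \<inter> U \<times> U)" using sym_rtrancl[OF assms] by (auto simp: sym_def)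
  show "trans (E\<^sup>* \<inter> U \<times> U)" by (rule transI) (use rtrancl_trans in fast)
qed (auto simp: refl_on_def)

lemma partition_on_connected_classes: "sym E \<Longrightarrow> partition_on U (connected_classes U E)"
  unfolding connected_classes_def by (intro partition_on_quotient equiv_connected)

lemma rtrancl_closed: "E `` W \<subseteq> W \<Longrightarrow> x \<in> W \<Longrightarrow> (x, y) \<in> E\<^sup>* \<Longrightarrow> y \<in> W"
  by (erule rtrancl_induct) auto

lemma in_connected_class_iff:
  assumes "sym E" "C \<in> connected_classes U E" "x \<in> C"
  shows "y \<in> C \<longleftrightarrow> y \<in> U \<and> (x, y) \<in> E\<^sup>*"
proof -
  obtain z where z: "C = (E\<^sup>* \<inter> U \<times> U) `` {z}"
    using assms(2) unfolding connected_classes_def by (rule quotientE)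
  then have "(z, x) \<in> E\<^sup>*" "z \<in> U" using assms(3) by auto
  moreover from this have "(x, z) \<in> E\<^sup>*" using symD[OF sym_rtrancl[OF assms(1)]] by blast
  ultimately have "(z, y) \<in> E\<^sup>* \<longleftrightarrow> (x, y) \<in> E\<^sup>*" using rtrancl_trans[of _ _ E] by blast
  then show ?thesis using z \<open>z \<in> U\<close> by auto
qed

lemma saturated_connected_classes:
  assumes sym: "sym E" and "T \<subseteq> U"
  shows "saturated (connected_classes U E) T \<longleftrightarrow> E\<^sup>* `` T \<inter> U = T"
proof
  assume sat: "saturated (connected_classes U E) T"
  have "y \<in> T" if "x \<in> T" "(x, y) \<in> E\<^sup>*" "y \<in> U" for x y
  proof -
    have "x \<in> U" using that assms(2) by blast
    then obtain C where C: "C \<in> connected_classes U E" "x \<in> C"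
      using partition_onD1[OF partition_on_connected_classes[OF sym]] by blast
    then have "y \<in> C" using in_connected_class_iff[OF sym] that by blast
    then show ?thesis using sat C \<open>x \<in> T\<close> unfolding saturated_def by blast
  qed
  then show "E\<^sup>* `` T \<inter> U = T" using assms(2) by blast
next
  assume "E\<^sup>* `` T \<inter> U = T"
  then show "saturated (connected_classes U E) T"
    unfolding saturated_def using in_connected_class_iff[OF sym] by blast
qed

text \<open>
  A closed set with trace \<open>T\<close> on the outer vertices \<open>U\<close> contains everything reachable from \<open>T\<close>. If
  that already adds outer vertices to \<open>T\<close>, no such set exists. Otherwise a closed set with
  trace \<open>T\<close> consists of the vertices reachable from \<open>T\<close> together with arbitrarily many of the
  components that avoid \<open>U\<close>, and distinct choices give distinct sets.
\<close>

lemma card_closed_sets_with_trace: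
  assumes fin: "finite V" and E: "E \<subseteq> V \<times> V" and sym: "sym E" and "U \<subseteq> V" "T \<subseteq> U"
  shows "card {W. W \<subseteq> V \<and> E `` W \<subseteq> W \<and> W \<inter> U = T} =
    of_bool (saturated (connected_classes U E) T) *
      2 ^ card {C \<in> connected_classes V E. C \<inter> U = {}}"
proof (cases "E\<^sup>* `` T \<inter> U = T")
  case False
  have "{W. W \<subseteq> V \<and> E `` W \<subseteq> W \<and> W \<inter> U = T} = {}"
  proof (rule ccontr)
    assume "{W. W \<subseteq> V \<and> E `` W \<subseteq> W \<and> W \<inter> U = T} \<noteq> {}"
    then obtain W where W: "E `` W \<subseteq> W" "W \<inter> U = T" by blast
    then have "E\<^sup>* `` T \<subseteq> W" using rtrancl_closed[OF W(1)] by blast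
    then show False using False W(2) \<open>T \<subseteq> U\<close> by blast
  qed
  moreover have "\<not> saturated (connected_classes U E) T"
    using False saturated_connected_classes[OF sym \<open>T \<subseteq> U\<close>] by simp
  ultimately show ?thesis by (simp only: card.empty of_bool_eq mult_zero_left if_False)
next
  case True
  define F where "F = {C \<in> connected_classes V E. C \<inter> U = {}}"
  define H where "H = E\<^sup>* `` T"
  have P: "partition_on V (connected_classes V E)"
    by (rule partition_on_connected_classes[OF sym])
  have reach_sym: "(x, y) \<in> E\<^sup>* \<Longrightarrow> (y, x) \<in> E\<^sup>*" for x y
    using sym_rtrancl[OF sym] by (rule symD)
  have reach_V: "(x, y) \<in> E\<^sup>* \<Longrightarrow> x \<in> V \<Longrightarrow> y \<in> V" for x y
    using rtrancl_closed[of E V x y] E by blast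
  have classD: "y \<in> C \<longleftrightarrow> (x, y) \<in> E\<^sup>*" if "C \<in> connected_classes V E" "x \<in> C" for C x y
    using in_connected_class_iff[OF sym that, of y] in_connected_class_iff[OF sym that, of x]
      that(2) reach_V by blast
  have class_closed: "E `` C \<subseteq> C" if "C \<in> connected_classes V E" for C
    using classD[OF that] by blast
  have H: "H \<subseteq> V" "E `` H \<subseteq> H" "H \<inter> U = T"
    using True \<open>T \<subseteq> U\<close> \<open>U \<subseteq> V\<close> reach_V
    by (auto simp: H_def intro: rtrancl_into_rtrancl)
  have FV: "C \<subseteq> V" if "C \<in> F" for C
    using that partition_onD1[OF P] by (auto simp: F_def)
  have disj: "C \<inter> H = {}" if "C \<in> F" for C
  proof (rule ccontr)
    assume "C \<inter> H \<noteq> {}"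
    then obtain x t where x: "x \<in> C" "t \<in> T" "(t, x) \<in> E\<^sup>*" by (auto simp: H_def)
    then have "t \<in> C" using classD[of C x t] reach_sym that by (auto simp: F_def)
    then show False using that x(2) \<open>T \<subseteq> U\<close> by (auto simp: F_def)
  qed
  \<comment> \<open>A choice \<open>G\<close> of floating components is recovered from its closed set as those it contains.\<close>
  have "bij_betw (\<lambda>G. H \<union> \<Union>G) (Pow F) {W. W \<subseteq> V \<and> E `` W \<subseteq> W \<and> W \<inter> U = T}"
  proof (rule bij_betw_byWitness[where f' = "\<lambda>W. {C \<in> F. C \<subseteq> W}"])
    show "\<forall>G\<in>Pow F. {C \<in> F. C \<subseteq> H \<union> \<Union>G} = G"
    proof (intro ballI subset_antisym subsetI)
      fix G C assume G: "G \<in> Pow F" and C: "C \<in> {C \<in> F. C \<subseteq> H \<union> \<Union>G}"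
      have "C \<noteq> {}" using C partition_onD3[OF P] by (auto simp: F_def)
      then obtain x where "x \<in> C" by blast
      then obtain D where "D \<in> G" "x \<in> D" using C disj[of C] by blast
      then have "D = C"
        using partition_onD2[OF P] G C \<open>x \<in> C\<close> by (auto simp: disjoint_def F_def)
      then show "C \<in> G" using \<open>D \<in> G\<close> by simp
    qed auto
    show "\<forall>W\<in>{W. W \<subseteq> V \<and> E `` W \<subseteq> W \<and> W \<inter> U = T}. H \<union> \<Union>{C \<in> F. C \<subseteq> W} = W"
    proof (intro ballI subset_antisym subsetI)
      fix W x assume W: "W \<in> {W. W \<subseteq> V \<and> E `` W \<subseteq> W \<and> W \<inter> U = T}"
        and "x \<in> H \<union> \<Union>{C \<in> F. C \<subseteq> W}"
      then show "x \<in> W" using rtrancl_closed[of E W] by (auto simp: H_def)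
    next
      fix W x assume W: "W \<in> {W. W \<subseteq> V \<and> E `` W \<subseteq> W \<and> W \<inter> U = T}" and "x \<in> W"
      then obtain C where C: "C \<in> connected_classes V E" "x \<in> C"
        using partition_onD1[OF P] by blast
      have CW: "C \<subseteq> W"
        using classD[OF C] rtrancl_closed[of E W x] W \<open>x \<in> W\<close> by blast
      show "x \<in> H \<union> \<Union>{C \<in> F. C \<subseteq> W}"
      proof (cases "C \<inter> U = {}")
        case True
        then show ?thesis using C CW by (auto simp: F_def)
      next
        case False
        then obtain y where "y \<in> C" "y \<in> T" using CW W by blast
        then have "x \<in> H" using classD[OF C(1), of y x] C(2) by (auto simp: H_def)
        then show ?thesis by blast
      qed
    qed
    show "(\<lambda>G. H \<union> \<Union>G) ` Pow F \<subseteq> {W. W \<subseteq> V \<and> E `` W \<subseteq> W \<and> W \<inter> U = T}"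
    proof (intro image_subsetI CollectI conjI)
      fix G assume G: "G \<in> Pow F"
      show "H \<union> \<Union>G \<subseteq> V" using H(1) FV G by blast
      have "E `` C \<subseteq> C" if "C \<in> G" for C
        using that G class_closed[of C] by (auto simp: F_def)
      then show "E `` (H \<union> \<Union>G) \<subseteq> H \<union> \<Union>G" using H(2) by blast
      show "(H \<union> \<Union>G) \<inter> U = T" using H(3) G unfolding F_def by blast
    qed
  qed auto
  then have "card {W. W \<subseteq> V \<and> E `` W \<subseteq> W \<and> W \<inter> U = T} = card (Pow F)"
    by (simp add: bij_betw_same_card)
  moreover have "finite F"
    using finite_elements[OF fin P] by (simp add: F_def)
  ultimately show ?thesis
    using True saturated_connected_classes[OF sym \<open>T \<subseteq> U\<close>]
    by (simp add: card_Pow F_def)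
qed

section \<open>Entries of block matrices\<close>

text \<open>
  The subset \<open>X \<union> Y'\<close> of the vertices that belongs to the matrix position in row \<open>r\<close> and column \<open>c\<close>.
\<close>

definition vertex_subset :: "nat \<Rightarrow> nat \<Rightarrow> nat \<Rightarrow> nat \<Rightarrow> vertex set" where
  "vertex_subset m n r c = Upper ` subset_at m r \<union> Lower ` subset_at n c"

lemma vertex_subset_subset: "vertex_subset m n r c \<subseteq> vertices m n"
  using subset_at_subset by (fastforce simp: vertex_subset_def vertices_def)

lemma subset_at_inj: "r < 2 ^ n \<Longrightarrow> s < 2 ^ n \<Longrightarrow> subset_at n r = subset_at n s \<longleftrightarrow> r = s"
  by (metis subset_index_at)

lemma vertex_subset_surj:
  assumes "Q \<subseteq> vertices m n"
  obtains r c where "r < 2 ^ m" "c < 2 ^ n" "Q = vertex_subset m n r c"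
proof -
  have X: "Upper -` Q \<subseteq> {1..m}" and Y: "Lower -` Q \<subseteq> {1..n}"
    using assms by (auto simp: vertices_def)
  have "Q = Upper ` (Upper -` Q) \<union> Lower ` (Lower -` Q)"
    using assms by (auto simp: vertices_def)
  then have "Q = vertex_subset m n (subset_index m (Upper -` Q)) (subset_index n (Lower -` Q))"
    by (simp add: vertex_subset_def subset_at_index[OF X] subset_at_index[OF Y])
  then show thesis
    using that subset_index_less[OF X] subset_index_less[OF Y] by blast
qed

lemma partitionsD:
  assumes "a \<in> partitions m n"
  shows "upper a = m" "lower a = n" "partition_on (vertices m n) (blocks a)"
  using assms by (auto simp: partitions_def)

lemma Union_blocks: "a \<in> partitions m n \<Longrightarrow> \<Union>(blocks a) = vertices m n"
  using partitionsD(3) partition_onD1 by metis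

lemma block_matrix_entry:
  assumes "a \<in> partitions m n" "r < 2 ^ m" "c < 2 ^ n"
  shows "block_matrix a $$ (r, c) =
    (of_nat (of_bool (saturated (blocks a) (vertex_subset m n r c))) :: 'k::ring_1)"
  using saturated_iff_union_of_blocks[OF partitionsD(3)[OF assms(1)] vertex_subset_subset]
    assms partitionsD(1,2)[OF assms(1)]
  by (simp add: block_matrix_def vertex_subset_def)

lemma rho_Tw_carrier: "a \<in> partitions m n \<Longrightarrow> rho (Tw i a) \<in> carrier_mat (2 ^ m) (2 ^ n)"
  by (auto simp: block_matrix_def partitionsD)

text \<open>
  Writing the entry as the image of a natural number makes it commute with all the others, whatever
  the ring.
\<close>

lemma rho_Tw_entry:
  assumes "a \<in> partitions m n" "r < 2 ^ m" "c < 2 ^ n"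
  shows "rho (Tw i a) $$ (r, c) =
    (of_nat (2 ^ i * of_bool (saturated (blocks a) (vertex_subset m n r c))) :: 'k::ring_1)"
  using assms block_matrix_entry[OF assms, where 'k = 'k]
  by (simp add: block_matrix_def partitionsD)

section \<open>Products\<close>

lemma product_edges_eq:
  "product_edges a b =
    (\<Union>A \<in> (`) lower_to_middle ` blocks a \<union> (`) upper_to_middle ` blocks b. A \<times> A)"
  by (simp add: product_edges_def UN_Un)

lemma sym_product_edges: "sym (product_edges a b)"
  unfolding product_edges_def sym_def by blast

lemma diagram_product_partition:
  assumes "a \<in> partitions m n" "b \<in> partitions n t"
  shows "diagram_product a b \<in> partitions m t"
  unfolding diagram_product_def partitions_def
  using partition_on_connected_classes[OF sym_product_edges] assms
  by (simp add: partitionsD[OF assms(1)] partitionsD[OF assms(2)])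

lemma product_closed_iff:
  assumes a: "a \<in> partitions m n" and b: "b \<in> partitions n t"
  shows "product_edges a b `` (Upper ` X \<union> Middle ` Z \<union> Lower ` Y) \<subseteq> Upper ` X \<union> Middle ` Z \<union> Lower ` Y
    \<longleftrightarrow> saturated (blocks a) (Upper ` X \<union> Lower ` Z) \<and> saturated (blocks b) (Upper ` Z \<union> Lower ` Y)"
proof -
  let ?W = "Upper ` X \<union> Middle ` Z \<union> Lower ` Y"
  have "product_edges a b `` ?W \<subseteq> ?W \<longleftrightarrow>
      saturated ((`) lower_to_middle ` blocks a \<union> (`) upper_to_middle ` blocks b) ?W"
    by (simp only: product_edges_eq Image_cliques_subset_iff)
  also have "\<dots> \<longleftrightarrow> saturated (blocks a) (lower_to_middle -` ?W) \<and>
      saturated (blocks b) (upper_to_middle -` ?W)"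
    by (simp only: saturated_Un saturated_image)
  also have "saturated (blocks a) (lower_to_middle -` ?W) \<longleftrightarrow>
      saturated (blocks a) (Upper ` X \<union> Lower ` Z)"
    by (rule saturated_cong) (auto simp: Union_blocks[OF a] vertices_def)
  also have "saturated (blocks b) (upper_to_middle -` ?W) \<longleftrightarrow>
      saturated (blocks b) (Upper ` Z \<union> Lower ` Y)"
    by (rule saturated_cong) (auto simp: Union_blocks[OF b] vertices_def)
  finally show ?thesis .
qed

text \<open>
  The index \<open>k\<close> of a subset \<open>Z\<close> of the middle row corresponds to the closed set
  \<open>X \<union> Z'' \<union> Y'\<close> of the product graph, so the positions \<open>k\<close> that contribute to a product entry are
  counted by \<open>card_closed_sets_with_trace\<close>. The components that avoid the outer rows are exactly
  the floating ones.
\<close>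

lemma card_intermediate_subsets:
  assumes a: "a \<in> partitions m n" and b: "b \<in> partitions n t"
  shows "card {k \<in> {..<2 ^ n}. saturated (blocks a) (vertex_subset m n r k) \<and>
      saturated (blocks b) (vertex_subset n t k c)} =
    of_bool (saturated (blocks (diagram_product a b)) (vertex_subset m t r c)) * 2 ^ floating a b"
proof -
  note ab = partitionsD[OF a] partitionsD[OF b]
  define V where "V = product_vertices a b"
  define E where "E = product_edges a b"
  define U where "U = vertices m t"
  define T where "T = vertex_subset m t r c"
  define w where "w k = Upper ` subset_at m r \<union> Middle ` subset_at n k \<union> Lower ` subset_at t c" for k
  have V: "V = Upper ` {1..m} \<union> Middle ` {1..n} \<union> Lower ` {1..t}"
    by (simp add: V_def product_vertices_def ab)
  have fin: "finite V" and UV: "U \<subseteq> V" and TU: "T \<subseteq> U"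
    using vertex_subset_subset by (auto simp: V U_def T_def vertices_def)
  have sub: "A \<in> blocks a \<Longrightarrow> A \<subseteq> vertices m n" "A \<in> blocks b \<Longrightarrow> A \<subseteq> vertices n t" for A
    using Union_blocks[OF a] Union_blocks[OF b] by auto
  have "lower_to_middle ` A \<subseteq> V" if "A \<in> blocks a" for A
    using sub(1)[OF that] by (auto simp: V vertices_def)
  moreover have "upper_to_middle ` A \<subseteq> V" if "A \<in> blocks b" for A
    using sub(2)[OF that] by (auto simp: V vertices_def)
  ultimately have EV: "E \<subseteq> V \<times> V" unfolding E_def product_edges_def by blast
  have sym: "sym E" unfolding E_def by (rule sym_product_edges)
  have "bij_betw w {k \<in> {..<2 ^ n}. saturated (blocks a) (vertex_subset m n r k) \<and>
      saturated (blocks b) (vertex_subset n t k c)} {W. W \<subseteq> V \<and> E `` W \<subseteq> W \<and> W \<inter> U = T}"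
  proof (rule bij_betw_imageI)
    show "inj_on w {k \<in> {..<2 ^ n}. saturated (blocks a) (vertex_subset m n r k) \<and>
      saturated (blocks b) (vertex_subset n t k c)}"
    proof (rule inj_onI)
      fix k l assume kl: "k \<in> {k \<in> {..<2 ^ n}. saturated (blocks a) (vertex_subset m n r k) \<and>
          saturated (blocks b) (vertex_subset n t k c)}"
        "l \<in> {k \<in> {..<2 ^ n}. saturated (blocks a) (vertex_subset m n r k) \<and>
          saturated (blocks b) (vertex_subset n t k c)}" and eq: "w k = w l"
      have "Middle -` w k = subset_at n k" for k by (auto simp: w_def)
      then have "subset_at n k = subset_at n l" using eq by metis
      then show "k = l" using kl subset_at_inj by auto
    qed
    have closed: "E `` w k \<subseteq> w k \<longleftrightarrow> saturated (blocks a) (vertex_subset m n r k) \<and>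
        saturated (blocks b) (vertex_subset n t k c)" for k
      unfolding E_def w_def vertex_subset_def by (rule product_closed_iff[OF a b])
    have wV: "w k \<subseteq> V" "w k \<inter> U = T" for k
      using subset_at_subset[of m r] subset_at_subset[of n k] subset_at_subset[of t c]
      by (auto simp: V w_def U_def T_def vertices_def vertex_subset_def)
    show "w ` {k \<in> {..<2 ^ n}. saturated (blocks a) (vertex_subset m n r k) \<and>
      saturated (blocks b) (vertex_subset n t k c)} = {W. W \<subseteq> V \<and> E `` W \<subseteq> W \<and> W \<inter> U = T}"
    proof (intro subset_antisym subsetI)
      fix W assume "W \<in> {W. W \<subseteq> V \<and> E `` W \<subseteq> W \<and> W \<inter> U = T}"
      then have W: "W \<subseteq> V" "E `` W \<subseteq> W" "W \<inter> U = T" by auto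
      have Z: "Middle -` W \<subseteq> {1..n}" using W(1) by (auto simp: V)
      let ?k = "subset_index n (Middle -` W)"
      have "W = T \<union> Middle ` (Middle -` W)" using W(1,3) by (auto simp: V U_def vertices_def)
      then have eq: "W = w ?k"
        unfolding w_def subset_at_index[OF Z] by (auto simp: T_def vertex_subset_def)
      then have "saturated (blocks a) (vertex_subset m n r ?k) \<and>
          saturated (blocks b) (vertex_subset n t ?k c)"
        using closed[of ?k] W(2) by metis
      then show "W \<in> w ` {k \<in> {..<2 ^ n}. saturated (blocks a) (vertex_subset m n r k) \<and>
          saturated (blocks b) (vertex_subset n t k c)}"
        using subset_index_less[OF Z] eq by blast
    qed (use closed wV in blast)
  qed
  then have "card {k \<in> {..<2 ^ n}. saturated (blocks a) (vertex_subset m n r k) \<and>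
      saturated (blocks b) (vertex_subset n t k c)} =
      card {W. W \<subseteq> V \<and> E `` W \<subseteq> W \<and> W \<inter> U = T}"
    by (rule bij_betw_same_card)
  also have "\<dots> = of_bool (saturated (connected_classes U E) T) *
      2 ^ card {C \<in> connected_classes V E. C \<inter> U = {}}"
    by (rule card_closed_sets_with_trace[OF fin EV sym UV TU])
  also have "connected_classes U E = blocks (diagram_product a b)"
    by (simp add: diagram_product_def U_def E_def ab)
  also have "{C \<in> connected_classes V E. C \<inter> U = {}} =
      {C \<in> connected_classes V E. C \<subseteq> Middle ` {1..lower a}}"
  proof (rule Collect_cong, rule conj_cong[OF refl])
    fix C assume "C \<in> connected_classes V E"
    then have "C \<subseteq> V" using partition_onD1[OF partition_on_connected_classes[OF sym]] by blast
    then show "C \<inter> U = {} \<longleftrightarrow> C \<subseteq> Middle ` {1..lower a}"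
      by (auto simp: V U_def vertices_def ab)
  qed
  also have "card \<dots> = floating a b" by (simp add: floating_def V_def E_def)
  finally show ?thesis unfolding T_def .
qed

lemma rho_mult:
  assumes a: "a \<in> partitions m n" and b: "b \<in> partitions n t"
  shows "rho (Tw i a) * rho (Tw j b) =
    (rho (Tw (i + j + floating a b) (diagram_product a b)) :: 'k::ring_1 mat)"
proof (rule eq_matI)
  note ab = diagram_product_partition[OF a b]
  note carr = rho_Tw_carrier[OF a, of i, where 'a = 'k] rho_Tw_carrier[OF b, of j, where 'a = 'k]
    rho_Tw_carrier[OF ab, of "i + j + floating a b", where 'a = 'k]
  show "dim_row (rho (Tw i a) * rho (Tw j b) :: 'k mat) = dim_row (rho (Tw (i + j + floating a b) (diagram_product a b)) :: 'k mat)"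
    "dim_col (rho (Tw i a) * rho (Tw j b) :: 'k mat) = dim_col (rho (Tw (i + j + floating a b) (diagram_product a b)) :: 'k mat)"
    using carr by (auto simp del: rho.simps)
  fix r c assume "r < dim_row (rho (Tw (i + j + floating a b) (diagram_product a b)) :: 'k mat)"
    "c < dim_col (rho (Tw (i + j + floating a b) (diagram_product a b)) :: 'k mat)"
  then have r: "r < 2 ^ m" and c: "c < 2 ^ t" using carr(3) by (auto simp del: rho.simps)
  let ?A = "\<lambda>k. saturated (blocks a) (vertex_subset m n r k)"
  let ?B = "\<lambda>k. saturated (blocks b) (vertex_subset n t k c)"
  have "(rho (Tw i a) * rho (Tw j b) :: 'k mat) $$ (r, c) =
      (\<Sum>k<2 ^ n. rho (Tw i a) $$ (r, k) * rho (Tw j b) $$ (k, c))"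
    using carr r c by (simp add: scalar_prod_def lessThan_atLeast0 del: rho.simps)
  also have "\<dots> = (\<Sum>k<2 ^ n. of_nat (2 ^ i * of_bool (?A k)) * of_nat (2 ^ j * of_bool (?B k)))"
    by (rule sum.cong) (simp_all add: rho_Tw_entry[OF a r] rho_Tw_entry[OF b _ c] del: rho.simps)
  also have "\<dots> = of_nat (\<Sum>k<2 ^ n. 2 ^ (i + j) * of_bool (?A k \<and> ?B k))"
    unfolding of_nat_sum of_nat_mult[symmetric]
    by (intro sum.cong arg_cong[where f = of_nat]) (simp_all add: power_add of_bool_conj)
  also have "(\<Sum>k<2 ^ n. 2 ^ (i + j) * of_bool (?A k \<and> ?B k)) =
      2 ^ (i + j) * card {k \<in> {..<2 ^ n}. ?A k \<and> ?B k}"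
    by (simp add: sum_distrib_left[symmetric] Int_def)
  also have "\<dots> = 2 ^ (i + j + floating a b) *
      of_bool (saturated (blocks (diagram_product a b)) (vertex_subset m t r c))"
    by (simp only: card_intermediate_subsets[OF a b] power_add mult_ac)
  also have "of_nat \<dots> = rho (Tw (i + j + floating a b) (diagram_product a b)) $$ (r, c)"
    by (rule rho_Tw_entry[OF ab r c, symmetric])
  finally show "(rho (Tw i a) * rho (Tw j b) :: 'k mat) $$ (r, c) =
      rho (Tw (i + j + floating a b) (diagram_product a b)) $$ (r, c)" .
qed

section \<open>Identities, involution and tensor operation\<close>

lemma diagram_id_eq: "diagram_id n = Diagram n n ((\<lambda>i. {Upper i, Lower i}) ` {1..n})"
  by (auto simp: diagram_id_def)

lemma diagram_id_partition: "diagram_id n \<in> partitions n n"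
  by (auto simp: diagram_id_eq partitions_def vertices_def partition_on_def disjoint_def)

lemma rho_id: "rho (Tw 0 (diagram_id n)) = (1\<^sub>m (2 ^ n) :: 'k::ring_1 mat)"
proof (rule eq_matI)
  note I = diagram_id_partition[of n]
  fix r c assume "r < dim_row (1\<^sub>m (2 ^ n) :: 'k mat)" "c < dim_col (1\<^sub>m (2 ^ n) :: 'k mat)"
  then have rc: "r < 2 ^ n" "c < 2 ^ n" by auto
  have "saturated (blocks (diagram_id n)) (vertex_subset n n r c) \<longleftrightarrow>
      (\<forall>x\<in>{1..n}. x \<in> subset_at n r \<longleftrightarrow> x \<in> subset_at n c)"
    by (auto simp: saturated_def diagram_id_eq vertex_subset_def image_iff)
  also have "\<dots> \<longleftrightarrow> subset_at n r = subset_at n c"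
    using subset_at_subset[of n] by blast
  also have "\<dots> \<longleftrightarrow> r = c" by (rule subset_at_inj[OF rc])
  finally show "rho (Tw 0 (diagram_id n)) $$ (r, c) = (1\<^sub>m (2 ^ n) :: 'k mat) $$ (r, c)"
    using rc by (simp add: rho_Tw_entry[OF I rc] del: rho.simps)
qed (use rho_Tw_carrier[OF diagram_id_partition[of n], of 0, where 'a = 'k] in auto)

lemma swap_vertex_vertices: "swap_vertex ` vertices m n = vertices n m"
  by (auto simp: vertices_def image_Un image_image)

lemma partition_on_inj_image_blocks:
  assumes "partition_on A P" "inj_on f A"
  shows "partition_on (f ` A) ((`) f ` P)"
proof -
  have "{} \<notin> (`) f ` P" using partition_onD3[OF assms(1)] by auto
  then show ?thesis using partition_on_inj_image[OF assms] by simp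
qed

lemma diagram_star_partition:
  assumes "a \<in> partitions m n"
  shows "diagram_star a \<in> partitions n m"
proof -
  have "swap_vertex (swap_vertex v) = v" for v by (cases v) auto
  then have "inj_on swap_vertex (vertices m n)" by (metis inj_onI)
  from partition_on_inj_image_blocks[OF partitionsD(3)[OF assms] this] show ?thesis
    by (simp add: diagram_star_def partitions_def partitionsD[OF assms] swap_vertex_vertices)
qed

lemma rho_star:
  assumes a: "a \<in> partitions m n"
  shows "rho (Tw i (diagram_star a)) = transpose_mat (rho (Tw i a) :: 'k::ring_1 mat)"
proof (rule eq_matI)
  note s = diagram_star_partition[OF a]
  note carr = rho_Tw_carrier[OF a, of i, where 'a = 'k] rho_Tw_carrier[OF s, of i, where 'a = 'k]
  show "dim_row (rho (Tw i (diagram_star a)) :: 'k mat) = dim_row (transpose_mat (rho (Tw i a) :: 'k mat))"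
    "dim_col (rho (Tw i (diagram_star a)) :: 'k mat) = dim_col (transpose_mat (rho (Tw i a) :: 'k mat))"
    using carr by (auto simp del: rho.simps)
  fix r c assume "r < dim_row (transpose_mat (rho (Tw i a) :: 'k mat))"
    "c < dim_col (transpose_mat (rho (Tw i a) :: 'k mat))"
  then have rc: "r < 2 ^ n" "c < 2 ^ m" using carr(1) by (auto simp del: rho.simps)
  have "saturated (blocks (diagram_star a)) (vertex_subset n m r c) \<longleftrightarrow>
      saturated (blocks a) (swap_vertex -` vertex_subset n m r c)"
    by (simp add: diagram_star_def saturated_image)
  also have "\<dots> \<longleftrightarrow> saturated (blocks a) (vertex_subset m n c r)"
    by (rule saturated_cong) (auto simp: Union_blocks[OF a] vertices_def vertex_subset_def)
  finally show "rho (Tw i (diagram_star a)) $$ (r, c) = transpose_mat (rho (Tw i a) :: 'k mat) $$ (r, c)"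
    using carr rc by (simp add: rho_Tw_entry[OF s rc] rho_Tw_entry[OF a rc(2,1)] del: rho.simps)
qed

lemma vertices_add: "vertices (m + s) (n + t) = vertices m n \<union> shift_vertex m n ` vertices s t"
proof -
  have cut: "{1..p + q} = {1..p} \<union> (\<lambda>x. x + p) ` {1..q}" for p q :: nat
    by (simp only: image_add_atLeastAtMost'[of p]) auto
  show ?thesis
    unfolding vertices_def cut
    by (simp add: image_Un image_image del: image_add_atLeastAtMost' image_add_atLeastAtMost) blast
qed

lemma diagram_sum_partition:
  assumes a: "a \<in> partitions m n" and b: "b \<in> partitions s t"
  shows "diagram_sum a b \<in> partitions (m + s) (n + t)"
proof -
  have inj: "inj_on (shift_vertex m n) (vertices s t)"
    by (auto simp: inj_on_def vertices_def)
  have disj: "vertices m n \<inter> shift_vertex m n ` vertices s t = {}"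
    by (auto simp: vertices_def)
  note P = partitionsD(3)[OF a] partition_on_inj_image_blocks[OF partitionsD(3)[OF b] inj]
  have "partition_on (vertices m n \<union> shift_vertex m n ` vertices s t)
      (blocks a \<union> (`) (shift_vertex m n) ` blocks b)"
  proof (rule partition_onI)
    fix p q assume pq: "p \<in> blocks a \<union> (`) (shift_vertex m n) ` blocks b"
      "q \<in> blocks a \<union> (`) (shift_vertex m n) ` blocks b" "p \<noteq> q"
    have subs1: "p \<subseteq> vertices m n" if "p \<in> blocks a" for p
      using that partition_onD1[OF P(1)] by blast
    have subs2: "p \<subseteq> shift_vertex m n ` vertices s t" if "p \<in> (`) (shift_vertex m n) ` blocks b" for p
      using that partition_onD1[OF P(2)] by blast
    have cross: "p \<inter> q = {}"
      if "p \<in> blocks a" "q \<in> (`) (shift_vertex m n) ` blocks b" for p q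
      using subs1[OF that(1)] subs2[OF that(2)] disj by blast
    from pq(1,2) show "disjnt p q"
    proof (elim UnE)
      assume "p \<in> blocks a" "q \<in> blocks a"
      then show ?thesis using pairwiseD[OF partition_onD2[OF P(1)]] pq(3) by blast
    next
      assume "p \<in> (`) (shift_vertex m n) ` blocks b" "q \<in> (`) (shift_vertex m n) ` blocks b"
      then show ?thesis using pairwiseD[OF partition_onD2[OF P(2)]] pq(3) by blast
    next
      assume "p \<in> blocks a" "q \<in> (`) (shift_vertex m n) ` blocks b"
      then show ?thesis unfolding disjnt_def by (rule cross)
    next
      assume "p \<in> (`) (shift_vertex m n) ` blocks b" "q \<in> blocks a"
      then show ?thesis unfolding disjnt_def using cross[of q p] by blast
    qed
  next
    show "\<Union>(blocks a \<union> (`) (shift_vertex m n) ` blocks b) =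
        vertices m n \<union> shift_vertex m n ` vertices s t"
      using P[THEN partition_onD1] by (simp only: Union_Un_distrib)
    show "{} \<notin> blocks a \<union> (`) (shift_vertex m n) ` blocks b"
      using P[THEN partition_onD3] by blast
  qed
  then show ?thesis
    by (simp add: diagram_sum_def partitions_def partitionsD[OF a] partitionsD[OF b] vertices_add)
qed

text \<open>
  Kronecker indices split by division with remainder, subset indices by the cut of \<open>{1..m + s}\<close>
  at \<open>m\<close>. They agree because \<open>subset_index\<close> gives the elements up to \<open>m\<close> the high-order bits.
\<close>

lemma subset_at_add:
  assumes "r < 2 ^ (m + s)"
  shows "subset_at (m + s) r = subset_at m (r div 2 ^ s) \<union> (\<lambda>u. u + m) ` subset_at s (r mod 2 ^ s)"
proof -
  have d: "r div 2 ^ s < 2 ^ m" using assms by (simp add: less_mult_imp_div_less power_add)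
  have "subset_index (m + s) (subset_at m (r div 2 ^ s) \<union> (\<lambda>u. u + m) ` subset_at s (r mod 2 ^ s)) = r"
    by (simp add: subset_index_union[OF subset_at_subset subset_at_subset] subset_index_at[OF d]
        subset_index_at)
  moreover have "subset_at m (r div 2 ^ s) \<union> (\<lambda>u. u + m) ` subset_at s (r mod 2 ^ s) \<subseteq> {1..m + s}"
    using subset_at_subset[of m "r div 2 ^ s"] subset_at_subset[of s "r mod 2 ^ s"] by fastforce
  ultimately show ?thesis using subset_at_index by metis
qed

text \<open>
  Each block of a sum of diagrams lies in one summand, so saturation splits into a condition
  on each summand, and the indicator of a conjunction is a product of indicators.
\<close>

lemma rho_kronecker:
  assumes a: "a \<in> partitions m n" and b: "b \<in> partitions s t"
  shows "kronecker (rho (Tw i a)) (rho (Tw j b)) = (rho (Tw (i + j) (diagram_sum a b)) :: 'k::ring_1 mat)"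
proof (rule eq_matI)
  note ab = diagram_sum_partition[OF a b]
  note carr = rho_Tw_carrier[OF a, of i, where 'a = 'k] rho_Tw_carrier[OF b, of j, where 'a = 'k]
    rho_Tw_carrier[OF ab, of "i + j", where 'a = 'k]
  show "dim_row (kronecker (rho (Tw i a)) (rho (Tw j b)) :: 'k mat) = dim_row (rho (Tw (i + j) (diagram_sum a b)) :: 'k mat)"
    "dim_col (kronecker (rho (Tw i a)) (rho (Tw j b)) :: 'k mat) = dim_col (rho (Tw (i + j) (diagram_sum a b)) :: 'k mat)"
    using carr by (auto simp: kronecker_def power_add simp del: rho.simps)
  fix r c assume "r < dim_row (rho (Tw (i + j) (diagram_sum a b)) :: 'k mat)"
    "c < dim_col (rho (Tw (i + j) (diagram_sum a b)) :: 'k mat)"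
  then have r: "r < 2 ^ (m + s)" and c: "c < 2 ^ (n + t)" using carr(3) by (auto simp del: rho.simps)
  define r1 r2 c1 c2 where "r1 = r div 2 ^ s" and "r2 = r mod 2 ^ s" and
    "c1 = c div 2 ^ t" and "c2 = c mod 2 ^ t"
  have lt: "r1 < 2 ^ m" "r2 < 2 ^ s" "c1 < 2 ^ n" "c2 < 2 ^ t"
    using r c by (simp_all add: r1_def r2_def c1_def c2_def less_mult_imp_div_less power_add)
  have Q: "vertex_subset (m + s) (n + t) r c =
      vertex_subset m n r1 c1 \<union> shift_vertex m n ` vertex_subset s t r2 c2"
    unfolding vertex_subset_def subset_at_add[OF r] subset_at_add[OF c]
    by (auto simp: r1_def r2_def c1_def c2_def image_Un image_image)
  have "saturated (blocks (diagram_sum a b)) (vertex_subset (m + s) (n + t) r c) \<longleftrightarrow>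
      saturated (blocks a) (vertex_subset (m + s) (n + t) r c) \<and>
      saturated (blocks b) (shift_vertex m n -` vertex_subset (m + s) (n + t) r c)"
    by (simp add: diagram_sum_def saturated_Un saturated_image partitionsD[OF a])
  also have "saturated (blocks a) (vertex_subset (m + s) (n + t) r c) \<longleftrightarrow>
      saturated (blocks a) (vertex_subset m n r1 c1)"
    unfolding Q using subset_at_subset[of s r2] subset_at_subset[of t c2]
    by (intro saturated_cong) (auto simp: Union_blocks[OF a] vertices_def vertex_subset_def)
  also have "saturated (blocks b) (shift_vertex m n -` vertex_subset (m + s) (n + t) r c) \<longleftrightarrow>
      saturated (blocks b) (vertex_subset s t r2 c2)"
    unfolding Q using subset_at_subset[of m r1] subset_at_subset[of n c1]
    by (intro saturated_cong) (auto simp: Union_blocks[OF b] vertices_def vertex_subset_def image_iff)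
  finally have sat: "saturated (blocks (diagram_sum a b)) (vertex_subset (m + s) (n + t) r c) \<longleftrightarrow>
      saturated (blocks a) (vertex_subset m n r1 c1) \<and> saturated (blocks b) (vertex_subset s t r2 c2)" .
  have "kronecker (rho (Tw i a)) (rho (Tw j b)) $$ (r, c) =
      (rho (Tw i a) $$ (r1, c1) * rho (Tw j b) $$ (r2, c2) :: 'k)"
    using carr r c by (simp add: kronecker_def r1_def r2_def c1_def c2_def power_add del: rho.simps)
  also have "\<dots> = of_nat (2 ^ (i + j) * of_bool (saturated (blocks (diagram_sum a b)) (vertex_subset (m + s) (n + t) r c)))"
    unfolding rho_Tw_entry[OF a lt(1,3)] rho_Tw_entry[OF b lt(2,4)] sat of_nat_mult[symmetric]
    by (intro arg_cong[where f = of_nat]) (simp add: power_add of_bool_conj)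
  also have "\<dots> = rho (Tw (i + j) (diagram_sum a b)) $$ (r, c)"
    by (rule rho_Tw_entry[OF ab r c, symmetric])
  finally show "kronecker (rho (Tw i a)) (rho (Tw j b)) $$ (r, c) =
      (rho (Tw (i + j) (diagram_sum a b)) :: 'k mat) $$ (r, c)" .
qed

lemma kronecker_zero_left: "kronecker (0\<^sub>m p q) (B :: 'k::ring_1 mat) = 0\<^sub>m (p * dim_row B) (q * dim_col B)"
  by (rule eq_matI) (auto simp: kronecker_def less_mult_imp_div_less)

lemma kronecker_zero_right: "kronecker (A :: 'k::ring_1 mat) (0\<^sub>m p q) = 0\<^sub>m (dim_row A * p) (dim_col A * q)"
proof (rule eq_matI)
  fix r c assume "r < dim_row (0\<^sub>m (dim_row A * p) (dim_col A * q) :: 'k mat)"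
    "c < dim_col (0\<^sub>m (dim_row A * p) (dim_col A * q) :: 'k mat)"
  moreover from this have "p > 0" "q > 0" by (auto intro: Nat.gr0I)
  ultimately show "kronecker A (0\<^sub>m p q) $$ (r, c) = 0\<^sub>m (dim_row A * p) (dim_col A * q) $$ (r, c)"
    by (simp add: kronecker_def)
qed (auto simp: kronecker_def)

section \<open>Powers of two and faithfulness\<close>

text \<open>
  Since \<open>of_nat\<close> kills exactly the multiples of the characteristic, the powers of two that vanish
  are exactly those beyond the twist bound.
\<close>

lemma of_nat_power2_eq_0_iff:
  assumes "CHAR('k::ring_1) = 2 ^ (d + 1)"
  shows "of_nat (2 ^ i) = (0 :: 'k) \<longleftrightarrow> d < i"
  unfolding of_nat_eq_0_iff_char_dvd assms
proof
  assume "(2::nat) ^ (d + 1) dvd 2 ^ i"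
  then have "d + 1 \<le> i" by (rule power_dvd_imp_le) simp
  then show "d < i" by simp
qed (simp add: le_imp_power_dvd del: power_Suc)

lemma of_nat_power2_inj:
  assumes "CHAR('k::ring_1) = 2 ^ (d + 1)" "i \<le> d" "j \<le> d"
    and "of_nat (2 ^ i) = (of_nat (2 ^ j) :: 'k)"
  shows "i = j"
proof -
  have "(2::nat) ^ i < 2 ^ (d + 1)" "(2::nat) ^ j < 2 ^ (d + 1)"
    using assms(2,3) by (intro power_strict_increasing; simp)+
  then have "(2::nat) ^ i = 2 ^ j"
    using assms(4) unfolding of_nat_eq_iff_cong_CHAR assms(1) cong_def by simp
  then show ?thesis by simp
qed

text \<open>
  Index \<open>0\<close> is the empty set, which is an empty union of blocks of any partition. This entry is
  therefore independent of the diagram and reads off the twist.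
\<close>

lemma rho_Tw_corner:
  assumes "a \<in> partitions m n"
  shows "rho (Tw i a) $$ (0, 0) = (of_nat (2 ^ i) :: 'k::ring_1)"
proof -
  have "vertex_subset m n 0 0 = {}" by (simp add: vertex_subset_def subset_at_def)
  then show ?thesis
    using rho_Tw_entry[OF assms, of 0 0 i, where 'k = 'k] by (simp add: saturated_def del: rho.simps)
qed

lemma rho_Tw_eq_0:
  assumes "CHAR('k::ring_1) = 2 ^ (d + 1)" "a \<in> partitions m n" "d < i"
  shows "rho (Tw i a) = (0\<^sub>m (2 ^ m) (2 ^ n) :: 'k mat)"
proof (rule eq_matI)
  note z = iffD2[OF of_nat_power2_eq_0_iff[OF assms(1)] assms(3)]
  fix r c assume "r < dim_row (0\<^sub>m (2 ^ m) (2 ^ n) :: 'k mat)" "c < dim_col (0\<^sub>m (2 ^ m) (2 ^ n) :: 'k mat)"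
  then show "rho (Tw i a) $$ (r, c) = (0\<^sub>m (2 ^ m) (2 ^ n) :: 'k mat) $$ (r, c)"
    using z by (simp add: rho_Tw_entry[OF assms(2)] del: rho.simps of_nat_power)
qed (use rho_Tw_carrier[OF assms(2), of i, where 'a = 'k] in \<open>auto simp del: rho.simps\<close>)

lemma rho_Tw_inj:
  assumes ch: "CHAR('k::ring_1) = 2 ^ (d + 1)"
    and a: "a \<in> partitions m n" "i \<le> d" and b: "b \<in> partitions m n" "j \<le> d"
    and eq: "rho (Tw i a) = (rho (Tw j b) :: 'k mat)"
  shows "i = j \<and> a = b"
proof -
  have ij: "i = j"
    using eq rho_Tw_corner[OF a(1), of i, where 'k = 'k] rho_Tw_corner[OF b(1), of j, where 'k = 'k]
    by (intro of_nat_power2_inj[OF ch a(2) b(2)]) (metis (no_types))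
  have nz: "of_nat (2 ^ i) \<noteq> (0 :: 'k)"
    using a(2) unfolding of_nat_power2_eq_0_iff[OF ch] by simp
  have "blocks a = blocks b"
  proof (rule partition_eqI_saturated[OF partitionsD(3)[OF a(1)] partitionsD(3)[OF b(1)]])
    fix Q assume "Q \<subseteq> vertices m n"
    then obtain r c where rc: "r < 2 ^ m" "c < 2 ^ n" and Q: "Q = vertex_subset m n r c"
      by (rule vertex_subset_surj)
    have "of_nat (2 ^ i * of_bool (saturated (blocks a) Q)) =
        (of_nat (2 ^ i * of_bool (saturated (blocks b) Q)) :: 'k)"
      unfolding Q rho_Tw_entry[OF a(1) rc, symmetric] rho_Tw_entry[OF b(1) rc, symmetric]
      using eq ij by simp
    then show "saturated (blocks a) Q \<longleftrightarrow> saturated (blocks b) Q"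
      using nz by (auto simp del: of_nat_power split: if_splits simp: of_bool_def)
  qed
  then have "a = b"
    using partitionsD(1,2)[OF a(1)] partitionsD(1,2)[OF b(1)] by (simp add: diagram.expand)
  with ij show ?thesis by simp
qed

lemma rho_hom:
  "f \<in> homset (twisted_category d) m n \<Longrightarrow> rho f \<in> carrier_mat (2 ^ m) (2 ^ n)"
  by (auto simp: homset_twisted_category simp del: rho.simps(1) intro: rho_Tw_carrier)

lemma inj_on_rho_homset:
  assumes ch: "CHAR('k::ring_1) = 2 ^ (d + 1)"
  shows "inj_on (rho :: twisted \<Rightarrow> 'k mat) (homset (twisted_category d) m n)"
proof -
  have "rho (Tw i a) \<noteq> (rho (TwZero m n) :: 'k mat)" if "a \<in> partitions m n" "i \<le> d" for i a
  proof
    assume "rho (Tw i a) = (rho (TwZero m n) :: 'k mat)"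
    then have "of_nat (2 ^ i) = (0 :: 'k)"
      using rho_Tw_corner[OF that(1), of i, where 'k = 'k] by (simp del: rho.simps(1) of_nat_power)
    then show False using that(2) unfolding of_nat_power2_eq_0_iff[OF ch] by simp
  qed
  then show ?thesis
    unfolding homset_twisted_category inj_on_def
    by (auto simp del: rho.simps dest: rho_Tw_inj[OF ch] dest!: sym[of "rho (TwZero m n)"])
qed

lemma inj_on_rho:
  assumes ch: "CHAR('k::ring_1) = 2 ^ (d + 1)"
  shows "inj_on (rho :: twisted \<Rightarrow> 'k mat) (mors (twisted_category d))"
proof (rule inj_onI)
  fix f g assume fg: "f \<in> mors (twisted_category d)" "g \<in> mors (twisted_category d)"
    and eq: "rho f = (rho g :: 'k mat)"
  have f: "f \<in> homset (twisted_category d) (tw_src f) (tw_tgt f)"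
    and g: "g \<in> homset (twisted_category d) (tw_src g) (tw_tgt g)"
    using fg by (auto simp: homset_def twisted_category_def)
  \<comment> \<open>The dimensions of the matrix determine the hom-set, even for zero morphisms.\<close>
  have "(2::nat) ^ tw_src f = 2 ^ tw_src g" "(2::nat) ^ tw_tgt f = 2 ^ tw_tgt g"
    using rho_hom[OF f, where 'a = 'k] rho_hom[OF g, where 'a = 'k] eq by auto
  then have "tw_src f = tw_src g" "tw_tgt f = tw_tgt g" by simp_all
  then show "f = g" using inj_on_rho_homset[OF ch] f g eq by (metis inj_onD)
qed

section \<open>The two categories and the representation\<close>

lemma twisted_homE:
  assumes "f \<in> homset (twisted_category d) m n"
  obtains i a where "f = Tw i a" "i \<le> d" "a \<in> partitions m n" | "f = TwZero m n"
  using assms unfolding homset_twisted_category by blast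

lemma Tw_hom_iff: "Tw i a \<in> homset (twisted_category d) m n \<longleftrightarrow> i \<le> d \<and> a \<in> partitions m n"
  by (auto simp: homset_twisted_category)

lemma TwZero_hom_iff: "TwZero p q \<in> homset (twisted_category d) m n \<longleftrightarrow> p = m \<and> q = n"
  by (auto simp: homset_twisted_category)

lemma twisted_comp_hom:
  "f \<in> homset (twisted_category d) m n \<Longrightarrow> g \<in> homset (twisted_category d) n t \<Longrightarrow>
    tw_comp d f g \<in> homset (twisted_category d) m t"
  by (elim twisted_homE) (simp_all add: Tw_hom_iff TwZero_hom_iff diagram_product_partition partitionsD)

lemma twisted_star_hom:
  "f \<in> homset (twisted_category d) m n \<Longrightarrow> tw_star f \<in> homset (twisted_category d) n m"
  by (elim twisted_homE) (simp_all add: Tw_hom_iff TwZero_hom_iff diagram_star_partition)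

lemma twisted_sum_hom:
  "f \<in> homset (twisted_category d) m n \<Longrightarrow> g \<in> homset (twisted_category d) s t \<Longrightarrow>
    tw_sum d f g \<in> homset (twisted_category d) (m + s) (n + t)"
  by (elim twisted_homE) (simp_all add: Tw_hom_iff TwZero_hom_iff diagram_sum_partition partitionsD)

lemma twisted_ident_hom: "Tw 0 (diagram_id n) \<in> homset (twisted_category d) n n"
  by (simp add: Tw_hom_iff diagram_id_partition)

text \<open>
  When the total twist exceeds \<open>d\<close>, the formula \<open>rho_mult\<close> still holds but with a power of
  two that is zero in the ring, which matches the zero morphism.
\<close>

lemma rho_comp:
  assumes ch: "CHAR('k::ring_1) = 2 ^ (d + 1)"
    and f: "f \<in> homset (twisted_category d) m n" and g: "g \<in> homset (twisted_category d) n t"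
  shows "rho (tw_comp d f g) = (rho f * rho g :: 'k mat)"
proof (cases f)
  case (Tw i a)
  have a: "a \<in> partitions m n" using f Tw by (auto simp: homset_twisted_category)
  show ?thesis
  proof (cases g)
    case g': (Tw j b)
    have b: "b \<in> partitions n t" using g g' by (auto simp: homset_twisted_category)
    show ?thesis
      using rho_mult[OF a b, of i j, where 'k = 'k]
        rho_Tw_eq_0[OF ch diagram_product_partition[OF a b], of "i + j + floating a b"]
      by (auto simp: Tw g' partitionsD[OF a] partitionsD[OF b] simp del: rho.simps(1))
  next
    case (TwZero p q)
    then have "g = TwZero n t" using g by (auto simp: homset_twisted_category)
    then show ?thesis
      using rho_hom[OF f, where 'a = 'k] by (simp add: Tw partitionsD[OF a] del: rho.simps(1))
  qed
next
  case (TwZero p q)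
  then have "f = TwZero m n" using f by (auto simp: homset_twisted_category)
  moreover have "tw_tgt g = t" using g by (auto simp: homset_def twisted_category_def)
  ultimately show ?thesis
    using rho_hom[OF g, where 'a = 'k] by (simp del: rho.simps(1))
qed

lemma rho_tensor:
  assumes ch: "CHAR('k::ring_1) = 2 ^ (d + 1)"
    and f: "f \<in> homset (twisted_category d) m n" and g: "g \<in> homset (twisted_category d) s t"
  shows "rho (tw_sum d f g) = (kronecker (rho f) (rho g) :: 'k mat)"
proof (cases f)
  case (Tw i a)
  have a: "a \<in> partitions m n" using f Tw by (auto simp: homset_twisted_category)
  show ?thesis
  proof (cases g)
    case g': (Tw j b)
    have b: "b \<in> partitions s t" using g g' by (auto simp: homset_twisted_category)
    show ?thesis
      using rho_kronecker[OF a b, of i j, where 'k = 'k]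
        rho_Tw_eq_0[OF ch diagram_sum_partition[OF a b], of "i + j"]
      by (auto simp: Tw g' partitionsD[OF a] partitionsD[OF b] simp del: rho.simps(1))
  next
    case (TwZero p q)
    then have "g = TwZero s t" using g by (auto simp: homset_twisted_category)
    then show ?thesis
      using rho_hom[OF f, where 'a = 'k]
      by (simp add: Tw partitionsD[OF a] kronecker_zero_right power_add del: rho.simps(1))
  qed
next
  case (TwZero p q)
  then have "f = TwZero m n" using f by (auto simp: homset_twisted_category)
  moreover have "tw_tgt g = t" "tw_src g = s" using g by (auto simp: homset_def twisted_category_def)
  ultimately show ?thesis
    using rho_hom[OF g, where 'a = 'k] by (simp add: kronecker_zero_left power_add del: rho.simps(1))
qed

lemma rho_tw_star:
  assumes "f \<in> homset (twisted_category d) m n"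
  shows "rho (tw_star f) = transpose_mat (rho f :: 'k::ring_1 mat)"
  using assms by (rule twisted_homE) (simp_all add: rho_star del: rho.simps(1))

lemma category_matrix: "category_with_ops (matrix_category :: (nat, 'k::ring_1 mat) cat_ops)"
  by unfold_locales
    (auto simp: homset_matrix_category, auto simp: matrix_category_def kronecker_def)

text \<open>
  The category laws are pulled back along \<open>rho\<close>: both sides of each law lie in one hom-set, on which
  \<open>rho\<close> is injective, and they have equal images because matrices satisfy the law.
\<close>

lemma category_twisted:
  assumes ch: "CHAR('k::ring_1) = 2 ^ (d + 1)"
  shows "category_with_ops (twisted_category d)"
proof
  let ?H = "homset (twisted_category d)" and ?rho = "rho :: twisted \<Rightarrow> 'k mat"
  have ops: "comp (twisted_category d) = tw_comp d"
    "ident (twisted_category d) = (\<lambda>n. Tw 0 (diagram_id n))"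
    by (simp_all add: twisted_category_def)
  note inj = inj_onD[OF inj_on_rho_homset[OF ch]]
  note I = twisted_ident_hom and C = twisted_comp_hom
  fix m n s t f g h
  show "ident (twisted_category d) m \<in> ?H m m" by (simp add: ops I)
  show "f \<in> ?H m n \<Longrightarrow> g \<in> ?H n s \<Longrightarrow> comp (twisted_category d) f g \<in> ?H m s"
    by (simp add: ops C)
  show "comp (twisted_category d) (ident (twisted_category d) m) f = f" if f: "f \<in> ?H m n"
    unfolding ops
  proof (rule inj[OF _ C[OF I f] f])
    show "?rho (tw_comp d (Tw 0 (diagram_id m)) f) = ?rho f"
      using rho_hom[OF f, where 'a = 'k] by (simp add: rho_comp[OF ch I f] rho_id del: rho.simps)
  qed
  show "comp (twisted_category d) f (ident (twisted_category d) n) = f" if f: "f \<in> ?H m n"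
    unfolding ops
  proof (rule inj[OF _ C[OF f I] f])
    show "?rho (tw_comp d f (Tw 0 (diagram_id n))) = ?rho f"
      using rho_hom[OF f, where 'a = 'k] by (simp add: rho_comp[OF ch f I] rho_id del: rho.simps)
  qed
  show "comp (twisted_category d) (comp (twisted_category d) f g) h =
      comp (twisted_category d) f (comp (twisted_category d) g h)"
    if f: "f \<in> ?H m n" and g: "g \<in> ?H n s" and h: "h \<in> ?H s t"
    unfolding ops
  proof (rule inj[OF _ C[OF C[OF f g] h] C[OF f C[OF g h]]])
    show "?rho (tw_comp d (tw_comp d f g) h) = ?rho (tw_comp d f (tw_comp d g h))"
      by (simp add: rho_comp[OF ch C[OF f g] h] rho_comp[OF ch f g] rho_comp[OF ch f C[OF g h]]
          rho_comp[OF ch g h] assoc_mult_mat[OF rho_hom[OF f] rho_hom[OF g] rho_hom[OF h]])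
  qed
qed (use twisted_star_hom twisted_sum_hom in \<open>simp_all add: twisted_category_def\<close>)

lemma monoid_endo_monoid:
  assumes "category_with_ops C" "x \<in> objs C"
  shows "Group.monoid (endo_monoid C x)"
proof -
  interpret category_with_ops C by fact
  show ?thesis
    by (rule Group.monoidI)
      (auto simp: endo_monoid_def assms ident_hom comp_hom ident_left ident_right comp_assoc)
qed

lemma (in category_rep) monoid_rep_endo_monoid:
  assumes "x \<in> objs S"
  shows "monoid_rep (endo_monoid S x) (endo_monoid T (F_obj x)) F_mor"
  unfolding monoid_rep_def
  using monoid_endo_monoid[OF source.category_with_ops_axioms assms]
    monoid_endo_monoid[OF target.category_with_ops_axioms map_obj[OF assms]] assms
  by (auto simp: endo_monoid_def hom_def map_hom map_comp map_ident)

theorem theorem4p3: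
  fixes d :: nat
  assumes "CHAR('k::ring_1) = 2 ^ (d + 1)"
  shows "faithful_rep (twisted_category d) (matrix_category :: (nat, 'k mat) cat_ops) (\<lambda>n. 2 ^ n) rho
    \<and> involutive_rep (twisted_category d) (matrix_category :: (nat, 'k mat) cat_ops) (\<lambda>n. 2 ^ n) rho
    \<and> tensor_rep (twisted_category d) (matrix_category :: (nat, 'k mat) cat_ops) (\<lambda>n. 2 ^ n) rho
    \<and> (\<forall>n. monoid_rep (endo_monoid (twisted_category d) n)
                (endo_monoid (matrix_category :: (nat, 'k mat) cat_ops) (2 ^ n)) rho
           \<and> inj_on (rho :: twisted \<Rightarrow> 'k mat) (homset (twisted_category d) n n)
           \<and> (\<forall>f \<in> homset (twisted_category d) n n.
                (rho (star (twisted_category d) f) :: 'k mat) = star matrix_category (rho f)))"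
proof -
  let ?S = "twisted_category d" and ?T = "matrix_category :: (nat, 'k mat) cat_ops"
  let ?rho = "rho :: twisted \<Rightarrow> 'k mat"
  have ops: "comp ?S = tw_comp d" "star ?S = tw_star" "tensor_mor ?S = tw_sum d"
    "ident ?S = (\<lambda>n. Tw 0 (diagram_id n))" "tensor_obj ?S = (+)" "objs ?S = UNIV"
    "comp ?T = (*)" "star ?T = transpose_mat" "tensor_mor ?T = kronecker"
    "ident ?T = 1\<^sub>m" "tensor_obj ?T = (*)" "objs ?T = UNIV"
    by (simp_all add: twisted_category_def matrix_category_def)
  have hom: "f \<in> homset ?S (tw_src f) (tw_tgt f)" if "f \<in> mors ?S" for f
    using that by (simp add: homset_def twisted_category_def)
  have star: "?rho (star ?S f) = star ?T (?rho f)" if "f \<in> homset ?S m n" for f m n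
    unfolding ops by (rule rho_tw_star[OF that])
  interpret source: category_with_ops ?S by (rule category_twisted[OF assms])
  interpret target: category_with_ops ?T by (rule category_matrix)
  interpret category_rep ?S ?T "\<lambda>n. 2 ^ n" ?rho
  proof
    fix f g m n t
    show "?rho f \<in> homset ?T (2 ^ m) (2 ^ n)" if "f \<in> homset ?S m n"
      unfolding homset_matrix_category by (rule rho_hom[OF that])
    show "?rho (comp ?S f g) = comp ?T (?rho f) (?rho g)"
      if "f \<in> homset ?S m n" "g \<in> homset ?S n t"
      unfolding ops by (rule rho_comp[OF assms that])
  qed (simp_all add: ops rho_id del: rho.simps)
  have "faithful_rep ?S ?T (\<lambda>n. 2 ^ n) ?rho"
    by unfold_locales (auto simp: inj_on_def intro: inj_onD[OF inj_on_rho[OF assms]])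
  moreover have "involutive_rep ?S ?T (\<lambda>n. 2 ^ n) ?rho"
    by unfold_locales (rule star[OF hom])
  moreover have "tensor_rep ?S ?T (\<lambda>n. 2 ^ n) ?rho"
  proof
    fix f g assume "f \<in> mors ?S" "g \<in> mors ?S"
    then show "?rho (tensor_mor ?S f g) = tensor_mor ?T (?rho f) (?rho g)"
      unfolding ops by (intro rho_tensor[OF assms hom hom])
  qed (simp add: ops power_add)
  moreover have "monoid_rep (endo_monoid ?S n) (endo_monoid ?T (2 ^ n)) ?rho" for n
    by (rule monoid_rep_endo_monoid) (simp add: ops)
  ultimately show ?thesis
    using inj_on_rho_homset[OF assms] star by blast
qed

end
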